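(* Let $a,b\ge 1$ be real numbers and $0\le p\le 1$. Then $$\frac12 p(1-p)\frac{(a-b)^2}{\max\{a,b\}}\le \frac12 E_p(a,b)\le d_p(a,b),$$ where $$E_p(a,b):=\min\left\{\frac{p(a-b)(a^{1-p}-b^{1-p})}{\left(\max\{a,b\}\right)^{1-p}},\ \frac{(1-p)(a-b)(a^{p}-b^{p})}{\left(\max\{a,b\}\right)^{p}}\right\}=E_{1-p}(a,b).$$
   Context: For real $a,b>0$ and $0\le p\le 1$, $d_p(a,b):=pa+(1-p)b-a^pb^{1-p}$. *)

theory Defs
  imports Complex_Main
begin

text \<open>The arguments \<open>a\<close>, \<open>b\<close> are meant to be positive, where \<open>powr\<close> is the usual real power
  (so that \<open>a powr 0 = 1\<close>).\<close>

definition d :: "real \<Rightarrow> real \<Rightarrow> real \<Rightarrow> real" where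
  "d p a b = p * a + (1 - p) * b - a powr p * b powr (1 - p)"

definition E :: "real \<Rightarrow> real \<Rightarrow> real \<Rightarrow> real" where
  "E p a b =
    min (p * (a - b) * (a powr (1 - p) - b powr (1 - p)) / (max a b) powr (1 - p))
        ((1 - p) * (a - b) * (a powr p - b powr p) / (max a b) powr p)"

end

theory Submission
  imports Defs
begin

text \<open>All quantities are homogeneous of degree one in \<open>(a, b)\<close>, and exchanging \<open>a\<close> with \<open>b\<close> is
  the same as exchanging \<open>p\<close> with \<open>1 - p\<close>. So take \<open>b \<le> a\<close>, scale \<open>a\<close> to \<open>1\<close> and put
  \<open>t = b / a \<in> (0, 1]\<close>. Everything then follows from the refined Young inequality
  (\<open>refined_young\<close>)
  \<open>p + (1 - p) t - t\<^sup>1\<^sup>-\<^sup>p \<ge> p/2 (1 - t) (1 - t\<^sup>1\<^sup>-\<^sup>p)\<close>.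
  Multiplied out, it reads \<open>p (1 - t\<^sup>2\<^sup>-\<^sup>p) \<ge> (2 - p) (t\<^sup>1\<^sup>-\<^sup>p - t)\<close>. Dividing by
  \<open>t\<^sup>1\<^sup>-\<^sup>p\<^sup>/\<^sup>2\<close> and writing \<open>t = e\<^sup>-\<^sup>u\<close>, \<open>\<beta> = p/2\<close>, \<open>\<alpha> = 1 - p/2\<close> makes both sides
  hyperbolic sines: it becomes \<open>\<beta> sinh (\<alpha> u) \<ge> \<alpha> sinh (\<beta> u)\<close>, that is, the
  monotonicity of \<open>sinh x / x\<close> on the positive axis (\<open>sinh_scaling_mono\<close>), since \<open>\<beta> \<le> \<alpha>\<close>.

  The refined inequality says that \<open>d p a b\<close> dominates half of the first entry of the minimum
  defining \<open>E\<close> when \<open>b \<le> a\<close>; in the opposite order the second entry plays this part. Because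
  its right-hand side is nonnegative, it also contains Bernoulli's inequality
  \<open>1 - t\<^sup>q \<ge> q (1 - t)\<close> (\<open>bernoulli_powr\<close>, with \<open>q = 1 - p\<close>), which bounds both entries below by
  \<open>p (1 - p) (a - b)\<^sup>2 / max a b\<close>.\<close>

text \<open>The division-free form of the monotonicity of \<open>sinh x / x\<close>: the difference of the two
  sides vanishes at \<open>u = 0\<close> and has derivative \<open>\<alpha> \<beta> (cosh (\<alpha> u) - cosh (\<beta> u)) \<ge> 0\<close>.\<close>

lemma sinh_scaling_mono:
  fixes \<alpha> \<beta> u :: real
  assumes "0 \<le> \<beta>" "\<beta> \<le> \<alpha>" "0 \<le> u"
  shows "\<alpha> * sinh (\<beta> * u) \<le> \<beta> * sinh (\<alpha> * u)"
proof -
  let ?h = "\<lambda>x. \<beta> * sinh (\<alpha> * x) - \<alpha> * sinh (\<beta> * x)"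
  have "?h 0 \<le> ?h u"
  proof (rule DERIV_nonneg_imp_nondecreasing[OF assms(3)])
    fix x :: real
    assume x: "0 \<le> x" "x \<le> u"
    have "(?h has_real_derivative \<alpha> * \<beta> * (cosh (\<alpha> * x) - cosh (\<beta> * x))) (at x)"
      by (auto intro!: derivative_eq_intros simp: algebra_simps)
    moreover have "cosh (\<beta> * x) \<le> cosh (\<alpha> * x)"
      using assms x by (subst cosh_real_nonneg_le_iff) (auto intro: mult_right_mono)
    ultimately show "\<exists>y. (?h has_real_derivative y) (at x) \<and> 0 \<le> y"
      using assms by (intro exI[of _ "\<alpha> * \<beta> * (cosh (\<alpha> * x) - cosh (\<beta> * x))"] conjI) auto
  qed
  then show ?thesis by simp
qed

text \<open>Both differences of powers are, up to the common factor \<open>2 t\<^sup>1\<^sup>-\<^sup>p\<^sup>/\<^sup>2\<close>, hyperbolic sines in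
  \<open>u = - ln t\<close>.\<close>

lemma refined_young:
  fixes p t :: real
  assumes "0 \<le> p" "p \<le> 1" "0 < t" "t \<le> 1"
  shows "p / 2 * ((1 - t) * (1 - t powr (1 - p))) \<le> p + (1 - p) * t - t powr (1 - p)"
proof -
  define u where "u = - ln t"
  define w where "w = exp (- (1 - p / 2) * u)"
  have u: "0 \<le> u" and t: "t = exp (- u)"
    using assms by (auto simp: u_def)
  have tq: "t powr (1 - p) = exp (- (1 - p) * u)"
    by (simp add: powr_def t algebra_simps)
  have alpha: "2 * w * sinh ((1 - p / 2) * u) = 1 - t * t powr (1 - p)"
    unfolding tq unfolding t w_def sinh_def
    by (simp add: algebra_simps flip: exp_add)
  have beta: "2 * w * sinh (p / 2 * u) = t powr (1 - p) - t"
    unfolding tq unfolding t w_def sinh_def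
    by (simp add: algebra_simps flip: exp_add)
  have "(1 - p / 2) * sinh (p / 2 * u) \<le> p / 2 * sinh ((1 - p / 2) * u)"
    using assms u by (intro sinh_scaling_mono) auto
  then have "2 * w * ((1 - p / 2) * sinh (p / 2 * u)) \<le> 2 * w * (p / 2 * sinh ((1 - p / 2) * u))"
    by (intro mult_left_mono) (auto simp: w_def)
  then have "(1 - p / 2) * (2 * w * sinh (p / 2 * u)) \<le> p / 2 * (2 * w * sinh ((1 - p / 2) * u))"
    by (simp only: mult_ac)
  then have "(1 - p / 2) * (t powr (1 - p) - t) \<le> p / 2 * (1 - t * t powr (1 - p))"
    unfolding alpha beta .
  then show ?thesis
    by (simp add: algebra_simps)
qed

lemma bernoulli_powr:
  fixes q t :: real
  assumes "0 \<le> q" "q \<le> 1" "0 < t" "t \<le> 1"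
  shows "q * (1 - t) \<le> 1 - t powr q"
proof -
  have "t powr q \<le> 1"
    using assms by (simp add: powr_le1)
  then have "0 \<le> (1 - q) / 2 * ((1 - t) * (1 - t powr q))"
    using assms by simp
  also have "\<dots> \<le> (1 - q) + q * t - t powr q"
    using refined_young[of "1 - q" t] assms by simp
  finally show ?thesis by (simp add: algebra_simps)
qed

text \<open>For \<open>q = 1 - p\<close> and \<open>q = p\<close> the left-hand side is an entry of the minimum defining \<open>E\<close>,
  stripped of its coefficient; homogeneity reduces it to the ratio \<open>b / a\<close>.\<close>

lemma gap_scale:
  fixes a b q :: real
  assumes "0 < b" "b \<le> a"
  shows "(a - b) * (a powr q - b powr q) / a powr q = a * ((1 - b / a) * (1 - (b / a) powr q))"
  using assms by (simp add: powr_divide field_simps)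

lemma gap_lower_bound:
  fixes a b q :: real
  assumes "0 < a" "0 < b" "0 \<le> q" "q \<le> 1"
  shows "q * ((a - b)\<^sup>2 / max a b) \<le> (a - b) * (a powr q - b powr q) / max a b powr q"
proof -
  have ordered: "q * ((x - y)\<^sup>2 / x) \<le> (x - y) * (x powr q - y powr q) / x powr q"
    if "0 < y" "y \<le> x" for x y :: real
  proof -
    have "q * ((x - y)\<^sup>2 / x) = x * ((1 - y / x) * (q * (1 - y / x)))"
      using that by (simp add: field_simps power2_eq_square)
    also have "\<dots> \<le> x * ((1 - y / x) * (1 - (y / x) powr q))"
      using that assms by (intro mult_left_mono bernoulli_powr) auto
    finally show ?thesis
      using gap_scale[OF that] by simp
  qed
  show ?thesis
  proof (cases "b \<le> a")
    case True
    then show ?thesis using ordered[of b a] assms by (simp add: max_def)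
  next
    case False
    then have "max a b = b" by simp
    moreover have "(b - a) * (b powr q - a powr q) = (a - b) * (a powr q - b powr q)"
      by (simp add: algebra_simps)
    ultimately show ?thesis
      using False ordered[of a b] assms by (simp add: power2_commute[of a b])
  qed
qed

lemma d_lower_bound:
  fixes a b p :: real
  assumes "0 < b" "b \<le> a" "0 \<le> p" "p \<le> 1"
  shows "p / 2 * ((a - b) * (a powr (1 - p) - b powr (1 - p)) / a powr (1 - p)) \<le> d p a b"
proof -
  define t where "t = b / a"
  have a: "0 < a" using assms by simp
  then have b: "b = a * t" and t: "0 < t" "t \<le> 1"
    using assms by (auto simp: t_def)
  have "a powr p * b powr (1 - p) = (a powr p * a powr (1 - p)) * t powr (1 - p)"
    using a t by (simp add: b powr_mult)
  also have "\<dots> = a * t powr (1 - p)"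
    using a by (simp flip: powr_add)
  finally have "d p a b = a * (p + (1 - p) * t - t powr (1 - p))"
    by (simp add: d_def b algebra_simps)
  moreover have "a * (p / 2 * ((1 - t) * (1 - t powr (1 - p))))
      \<le> a * (p + (1 - p) * t - t powr (1 - p))"
    using assms a t by (intro mult_left_mono refined_young) auto
  ultimately show ?thesis
    using gap_scale[OF assms(1,2), of "1 - p"] by (simp add: t_def mult_ac)
qed

lemma E_complement: "E p a b = E (1 - p) a b"
  by (simp add: E_def min.commute)

lemma E_swap: "E p a b = E p b a"
proof -
  have "(a - b) * (a powr r - b powr r) = (b - a) * (b powr r - a powr r)" for r
    by (simp add: algebra_simps)
  then show ?thesis
    unfolding E_def by (simp add: max.commute[of a b] mult.assoc)
qed

lemma d_swap: "d p a b = d (1 - p) b a"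
  by (simp add: d_def algebra_simps)

lemma E_lower_bound:
  fixes a b p :: real
  assumes "0 < a" "0 < b" "0 \<le> p" "p \<le> 1"
  shows "p * (1 - p) * ((a - b)\<^sup>2 / max a b) \<le> E p a b"
proof -
  have "p * ((1 - p) * ((a - b)\<^sup>2 / max a b))
      \<le> p * ((a - b) * (a powr (1 - p) - b powr (1 - p)) / max a b powr (1 - p))"
    using assms by (intro mult_left_mono gap_lower_bound) auto
  moreover have "(1 - p) * (p * ((a - b)\<^sup>2 / max a b))
      \<le> (1 - p) * ((a - b) * (a powr p - b powr p) / max a b powr p)"
    using assms by (intro mult_left_mono gap_lower_bound) auto
  ultimately show ?thesis
    by (simp add: E_def mult_ac)
qed

lemma E_le_d:
  fixes a b p :: real
  assumes "0 < a" "0 < b" "0 \<le> p" "p \<le> 1"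
  shows "1 / 2 * E p a b \<le> d p a b"
proof -
  have ordered: "1 / 2 * E r x y \<le> d r x y"
    if "0 < y" "y \<le> x" "0 \<le> r" "r \<le> 1" for x y r :: real
  proof -
    have "max x y = x" using that by simp
    then have "E r x y \<le> r * ((x - y) * (x powr (1 - r) - y powr (1 - r)) / x powr (1 - r))"
      by (simp add: E_def mult.assoc)
    then have "1 / 2 * E r x y
        \<le> r / 2 * ((x - y) * (x powr (1 - r) - y powr (1 - r)) / x powr (1 - r))"
      by simp
    also have "\<dots> \<le> d r x y"
      using that by (rule d_lower_bound)
    finally show ?thesis .
  qed
  show ?thesis
  proof (cases "b \<le> a")
    case True
    then show ?thesis using ordered assms by simp
  next
    case False
    then have "1 / 2 * E (1 - p) b a \<le> d (1 - p) b a"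
      using ordered assms by simp
    then show ?thesis
      by (simp add: d_swap[of p a b] E_complement[of p a b] E_swap[of "1 - p" a b])
  qed
qed

theorem theorem2p7:
  fixes a b p :: real
  assumes "a \<ge> 1" and "b \<ge> 1" and "0 \<le> p" and "p \<le> 1"
  shows "1 / 2 * p * (1 - p) * ((a - b)^2 / max a b) \<le> 1 / 2 * E p a b
       \<and> 1 / 2 * E p a b \<le> d p a b
       \<and> E p a b = E (1 - p) a b"
proof (intro conjI)
  have pos: "0 < a" "0 < b" using assms by auto
  show "1 / 2 * p * (1 - p) * ((a - b)^2 / max a b) \<le> 1 / 2 * E p a b"
    using E_lower_bound[OF pos assms(3,4)] by simp
  show "1 / 2 * E p a b \<le> d p a b"
    using E_le_d[OF pos assms(3,4)] .
  show "E p a b = E (1 - p) a b"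
    by (rule E_complement)
qed

end
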